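(* Let $N$ be large, put $k_0=\log\log N$, and let $k$ be an integer with $|k-k_0|\le k_0^{2/3}$. Suppose $\Delta\le 2^k/k^4$. Then the number of integers $n\in\mathcal{A}(N,k)$ that may be written as $x^2+dy^2$ with $x,y$ integers and $d$ an integer with $1\le d\le\Delta$ is $\ll N/k_0$.
   Context: $\Omega(n)$ denotes the number of prime factors of $n$ counted with multiplicity, and $\mathcal{A}(N,k)=\{n\le N:\ \Omega(n)=k\}$ ($n$ positive integers). The notation $A\ll B$ means $|A|\le CB$ for an absolute constant $C$. *)

theory Defs
  imports Complex_Main "HOL-Computational_Algebra.Primes"
begin

definition bigomega :: "nat \<Rightarrow> nat" where
  "bigomega n = size (prime_factorization n)"

text \<open>Positivity is required explicitly because \<open>prime_factorization 0\<close> is empty.\<close>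

definition almost_primes :: "real \<Rightarrow> nat \<Rightarrow> nat set" where
  "almost_primes N k = {n. 0 < n \<and> real n \<le> N \<and> bigomega n = k}"

end

(* Write n = e f, where f is the product of the odd primes dividing n exactly once and not
   dividing d. If n = x^2 + d y^2 then -d is a nonzero square modulo each prime factor of f, so -d
   has at least 2^(bigomega n - bigomega e) square roots modulo f. Hence, up to the factor
   2^(bigomega e), the number of n in question is at most 2^(-k) times the number of pairs (f, t)
   with f <= N/e and t^2 = -d mod f. Averaged over d, the number of these pairs is O(N/e): by
   reduction of binary quadratic forms, a pair (f, t) is encoded by a lattice vector (u, v) with
   u^2 + d v^2 = m f, m <= 2 sqrt d, and a square root of -d modulo m. The sum of
   2^(bigomega e) / e over the cofactors e is an Euler product bounded by O(k^2), so the
   assumption on Delta leaves O(N / k^2). Those n divisible by g^2 for some g > k_0 are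
   discarded beforehand; this keeps e small compared with N. *)
theory Submission
  imports Defs "HOL-Number_Theory.Number_Theory" "HOL-Computational_Algebra.Squarefree"
begin

section \<open>Square roots of $-d$ and short lattice vectors\<close>

definition neg_sqroots :: "int \<Rightarrow> int \<Rightarrow> int set" where
  "neg_sqroots d n = {t \<in> {0..<n}. n dvd t\<^sup>2 + d}"

lemma finite_neg_sqroots [simp]: "finite (neg_sqroots d n)"
  by (rule finite_subset[of _ "{0..<n}"]) (auto simp: neg_sqroots_def)

text \<open>The points (t v + n w, v) form a lattice of covolume n, so some nonzero one has norm x^2
  + d y^2 of order n * sqrt d. Coprimality of \<open>v\<close> and \<open>w\<close> is what later
  allows (v, w) to be completed to a unimodular matrix.\<close>

lemma short_lattice_vector:
  fixes d n t :: int
  assumes "n \<ge> 1" "d \<ge> 1"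
  obtains v w :: int where "coprime v w"
    "real_of_int ((t * v + n * w)\<^sup>2 + d * v\<^sup>2) \<le> 2 * sqrt d * n"
proof -
  \<comment> \<open>Thue's pigeonhole argument, with box sides \<open>U\<close>, \<open>V\<close> such that \<open>U * V = n\<close> and \<open>U\<^sup>2 = d * V\<^sup>2\<close>.\<close>
  define V where "V = sqrt (n / sqrt d)"
  define U where "U = sqrt (n * sqrt d)"
  have d0: "sqrt d > 0" and n0: "real_of_int n > 0" using assms by auto
  have U0: "U > 0" and V0: "V > 0" unfolding U_def V_def using d0 n0 by auto
  have UV: "U * V = n"
    unfolding U_def V_def using d0 n0 by (simp add: real_sqrt_mult[symmetric] power2_eq_square[symmetric])
  define a where "a = \<lfloor>U\<rfloor>"
  define b where "b = \<lfloor>V\<rfloor>"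
  have ab0: "a \<ge> 0" "b \<ge> 0" using U0 V0 by (auto simp: a_def b_def)
  have "real_of_int n < (a + 1) * (b + 1)"
  proof -
    have "U < real_of_int (a + 1)" "V < real_of_int (b + 1)" unfolding a_def b_def by linarith+
    then have "U * V < real_of_int (a + 1) * real_of_int (b + 1)"
      using U0 V0 ab0 by (intro mult_strict_mono) auto
    then show ?thesis using UV by simp
  qed
  then have nab: "n < (a + 1) * (b + 1)" by linarith
  define f where "f = (\<lambda>(x, y). (x - t * y) mod n)"
  have "\<not> inj_on f ({0..a} \<times> {0..b})"
  proof
    assume "inj_on f ({0..a} \<times> {0..b})"
    moreover have "f ` ({0..a} \<times> {0..b}) \<subseteq> {0..<n}" using assms by (auto simp: f_def)
    ultimately have "card ({0..a} \<times> {0..b}) \<le> card {0..<n}" by (intro card_inj_on_le) auto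
    then have "nat (a + 1) * nat (b + 1) \<le> nat n" by (simp add: card_cartesian_product)
    then have "nat ((a + 1) * (b + 1)) \<le> nat n" using ab0 by (simp add: nat_mult_distrib)
    then show False using nab assms by linarith
  qed
  then obtain x y x' y' where xy: "(x, y) \<noteq> (x', y')" "x \<in> {0..a}" "x' \<in> {0..a}" "y \<in> {0..b}" "y' \<in> {0..b}"
    and eq: "(x - t * y) mod n = (x' - t * y') mod n"
    unfolding inj_on_def f_def by (auto; blast)
  define v where "v = y - y'"
  from eq have "n dvd (x - t * y) - (x' - t * y')" by (simp add: mod_eq_dvd_iff)
  then obtain w where w: "(x - t * y) - (x' - t * y') = n * w" by (rule dvdE)
  then have xw: "x - x' = t * v + n * w" by (simp add: v_def algebra_simps)
  have nz: "v \<noteq> 0 \<or> w \<noteq> 0" using xy(1) xw by (auto simp: v_def)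
  have "\<bar>x - x'\<bar> \<le> a" "\<bar>v\<bar> \<le> b" using xy unfolding v_def by auto
  then have "\<bar>real_of_int (x - x')\<bar> \<le> U" "\<bar>real_of_int v\<bar> \<le> V"
    unfolding a_def b_def by linarith+
  then have sq: "(real_of_int (x - x'))\<^sup>2 \<le> U\<^sup>2" "(real_of_int v)\<^sup>2 \<le> V\<^sup>2"
    by (metis abs_ge_zero power2_abs power_mono)+
  have U2: "U\<^sup>2 = n * sqrt d" and V2: "V\<^sup>2 = n / sqrt d"
    unfolding U_def V_def using d0 n0 by auto
  have "real_of_int ((t * v + n * w)\<^sup>2 + d * v\<^sup>2) \<le> U\<^sup>2 + d * V\<^sup>2"
    using sq assms unfolding xw[symmetric] by (auto intro!: add_mono mult_left_mono)
  also have "d * V\<^sup>2 = n * (d / sqrt d)" by (simp add: V2)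
  also have "d / sqrt d = sqrt d" using assms by (intro real_div_sqrt) auto
  finally have bd: "real_of_int ((t * v + n * w)\<^sup>2 + d * v\<^sup>2) \<le> 2 * sqrt d * n"
    by (simp add: U2 mult_ac)
  \<comment> \<open>The form is homogeneous of degree 2, so dividing out the gcd does not increase
    its value.\<close>
  define g where "g = gcd v w"
  obtain v1 w1 where vw: "v = g * v1" "w = g * w1" "coprime v1 w1"
    using gcd_coprime_exists[of v w] nz unfolding g_def by (metis gcd_eq_0_iff mult.commute)
  have g1: "g\<^sup>2 \<ge> 1" using nz by (simp add: g_def int_one_le_iff_zero_less)
  define q where "q = (t * v1 + n * w1)\<^sup>2 + d * v1\<^sup>2"
  have q0: "q \<ge> 0" using assms by (simp add: q_def)
  have "(t * v + n * w)\<^sup>2 + d * v\<^sup>2 = g\<^sup>2 * q"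
    unfolding q_def vw by (simp add: algebra_simps power2_eq_square)
  moreover have "q \<le> g\<^sup>2 * q" using g1 q0 mult_right_mono[of 1 "g\<^sup>2" q] by simp
  ultimately have "real_of_int q \<le> 2 * sqrt d * n" using bd by linarith
  then show thesis using that[of v1 w1] vw(3) unfolding q_def by blast
qed

text \<open>The data \<open>m, s, u, v\<close> determine \<open>n\<close>, \<open>u'\<close>, \<open>v'\<close>, and then the last three conclusions determine
  \<open>t\<close> modulo \<open>n\<close>. In terms of ideals of norms \<open>n\<close> and \<open>m\<close>: the vector \<open>(u, v)\<close> is an element of
  the first one, and the second one is the complementary factor of the principal ideal it
  generates.\<close>

lemma dual_root:
  fixes d n t :: int
  assumes "n \<ge> 1" "d \<ge> 1" "n dvd t\<^sup>2 + d"
  obtains m s u v v' u' :: int where "m \<ge> 1" "real_of_int m \<le> 2 * sqrt d" "s \<in> neg_sqroots d m"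
    "m * n = u\<^sup>2 + d * v\<^sup>2" "s * v - u = m * v'" "s * u + d * v = m * u'"
    "coprime v v'" "n dvd t * v - u" "n dvd t * v' - u'"
proof -
  obtain v w where vw: "coprime v w" "real_of_int ((t * v + n * w)\<^sup>2 + d * v\<^sup>2) \<le> 2 * sqrt d * n"
    using short_lattice_vector[OF assms(1,2)] by blast
  define u where "u = t * v + n * w"
  obtain l where l: "t\<^sup>2 + d = n * l" using assms(3) by (rule dvdE)
  \<comment> \<open>The value at (v, w) of the form l X^2 + 2 t X Y + n Y^2 of discriminant -4 d;
    multiplying by n and completing the square gives u^2 + d v^2.\<close>
  define m where "m = l * v\<^sup>2 + 2 * t * v * w + n * w\<^sup>2"
  have mn: "m * n = u\<^sup>2 + d * v\<^sup>2"
  proof -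
    have "u\<^sup>2 + d * v\<^sup>2 = (t\<^sup>2 + d) * v\<^sup>2 + n * (2 * t * v * w + n * w\<^sup>2)"
      unfolding u_def by (simp add: algebra_simps power2_eq_square)
    then show ?thesis unfolding l m_def by (simp add: algebra_simps)
  qed
  have "u \<noteq> 0 \<or> v \<noteq> 0" using vw(1) assms(1) by (auto simp: u_def)
  then have "u\<^sup>2 + d * v\<^sup>2 > 0"
    using assms(2) by (cases "u = 0") (auto intro: add_pos_nonneg)
  then have "m * n > 0" using mn by simp
  then have m1: "m \<ge> 1" using assms(1) by (simp add: zero_less_mult_iff)
  have "real_of_int m * n \<le> 2 * sqrt d * n" using vw(2) mn unfolding u_def
    by (metis of_int_mult)
  then have m2: "real_of_int m \<le> 2 * sqrt d" using assms(1) by simp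
  obtain p0 q0 where "p0 * v + q0 * w = 1"
    using vw(1) by (metis bezout_int coprime_iff_gcd_eq_1)
  then have bz0: "v * p0 - w * (-q0) = 1" by (simp add: algebra_simps)
  \<comment> \<open>\<open>(v, w)\<close> is completed to a unimodular matrix, which transforms the form \<open>(l, 2t, n)\<close> into \<open>(m, 2s, m')\<close>.\<close>
  define s0 where "s0 = l * v * (-q0) + t * v * p0 + t * w * (-q0) + n * w * p0"
  \<comment> \<open>Subtracting \<open>j\<close> times (v, w) from the second vector (-q0, p0)
    changes \<open>s0\<close> by a multiple of m and brings it into the range that
    \<open>neg_sqroots\<close> demands.\<close>
  define j where "j = s0 div m"
  define v' where "v' = -q0 - j * v"
  define w' where "w' = p0 - j * w"
  define u' where "u' = t * v' + n * w'"
  define s where "s = l * v * v' + t * v * w' + t * w * v' + n * w * w'"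
  have bz: "v * w' - w * v' = 1" using bz0 by (simp add: v'_def w'_def algebra_simps)
  have "s = s0 - j * m" unfolding s_def s0_def v'_def w'_def m_def
    by (simp add: algebra_simps power2_eq_square)
  then have smod: "s = s0 mod m" by (simp add: j_def minus_div_mult_eq_mod)
  have e1: "s * v - u = m * v'"
  proof -
    have "s * v - m * v' = (v * w' - w * v') * (t * v + n * w)"
      unfolding s_def m_def by (simp add: algebra_simps power2_eq_square)
    then show ?thesis unfolding bz u_def by simp
  qed
  have e2: "s * u + d * v = m * u'"
  proof -
    have "s * u - m * u' = (v * w' - w * v') * (t * (t * v + n * w) - n * l * v - n * t * w)"
      unfolding s_def m_def u_def u'_def by (simp add: algebra_simps power2_eq_square)
    also have "\<dots> = t\<^sup>2 * v - (t\<^sup>2 + d) * v" unfolding bz l by (simp add: algebra_simps power2_eq_square)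
    finally show ?thesis by (simp add: algebra_simps)
  qed
  \<comment> \<open>The value of the form at the second vector. Invariance of the discriminant under
    the unimodular substitution gives s^2 + d = m m'.\<close>
  define m' where "m' = l * v'\<^sup>2 + 2 * t * v' * w' + n * w'\<^sup>2"
  have "s\<^sup>2 + d = m * m'"
  proof -
    have "s\<^sup>2 - m * m' = (v * w' - w * v')\<^sup>2 * (t\<^sup>2 - n * l)"
      unfolding s_def m_def m'_def by (simp add: algebra_simps power2_eq_square)
    then show ?thesis unfolding bz l[symmetric] by simp
  qed
  then have "s \<in> neg_sqroots d m" using m1 smod by (simp add: neg_sqroots_def)
  moreover have "coprime v v'"
  proof (rule coprimeI)
    fix c assume "c dvd v" "c dvd v'"
    then have "c dvd v * w' - w * v'" by simp
    then show "is_unit c" using bz by simp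
  qed
  moreover have "n dvd t * v - u" "n dvd t * v' - u'" by (simp_all add: u_def u'_def)
  ultimately show thesis using that[OF m1 m2 _ mn e1 e2] by blast
qed

text \<open>For encodings that are only known to exist: any choice of codes is injective, because a
  code determines its element.\<close>

lemma card_le_card_if_rel:
  assumes "finite B" "\<And>x. x \<in> A \<Longrightarrow> \<exists>y\<in>B. R x y"
    "\<And>x x' y. x \<in> A \<Longrightarrow> x' \<in> A \<Longrightarrow> R x y \<Longrightarrow> R x' y \<Longrightarrow> x = x'"
  shows "card A \<le> card B"
proof -
  obtain f where f: "\<And>x. x \<in> A \<Longrightarrow> f x \<in> B \<and> R x (f x)" using assms(2) by metis
  then have "inj_on f A" using assms(3) by (metis inj_onI)
  then show ?thesis using f assms(1) by (intro card_inj_on_le[of f]) auto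
qed

section \<open>Lattice points in an ellipse\<close>

lemma card_multiples_le:
  fixes m c :: int and Y :: real
  assumes "m \<ge> 1" "Y \<ge> 0"
  shows "finite {u::int. \<bar>real_of_int u\<bar> \<le> Y \<and> m dvd u - c}"
    "real (card {u::int. \<bar>real_of_int u\<bar> \<le> Y \<and> m dvd u - c}) \<le> 2 * Y / m + 1"
proof -
  let ?S = "{u::int. \<bar>real_of_int u\<bar> \<le> Y \<and> m dvd u - c}"
  have sub: "?S \<subseteq> {-\<lfloor>Y\<rfloor>..\<lfloor>Y\<rfloor>}" by (auto; linarith)
  then show "finite ?S" by (rule finite_subset) simp
  define A where "A = \<lceil>(- Y - c) / m\<rceil>"
  define B where "B = \<lfloor>(Y - c) / m\<rfloor>"
  have m0: "real_of_int m > 0" using assms by simp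
  have "?S \<subseteq> (\<lambda>j. c + m * j) ` {A..B}"
  proof
    fix u assume u: "u \<in> ?S"
    then obtain j where j: "u - c = m * j" by (auto elim: dvdE)
    then have "real_of_int u - c = m * j" by (metis of_int_diff of_int_mult)
    then have "m * real_of_int j \<le> Y - c" "- Y - c \<le> m * real_of_int j" using u by auto
    then have "j \<le> (Y - c) / m" "(- Y - c) / m \<le> j" using m0 by (auto simp: field_simps)
    then have "j \<in> {A..B}" unfolding A_def B_def by (auto simp: le_floor_iff ceiling_le_iff)
    moreover have "u = c + m * j" using j by simp
    ultimately show "u \<in> (\<lambda>j. c + m * j) ` {A..B}" by blast
  qed
  then have "card ?S \<le> card {A..B}"
    by (meson card_image_le card_mono finite_atLeastAtMost_int finite_imageI le_trans)
  moreover have "real (card {A..B}) \<le> 2 * Y / m + 1"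
  proof -
    have "real_of_int A \<ge> (- Y - c) / m" "real_of_int B \<le> (Y - c) / m" unfolding A_def B_def by auto
    moreover have "(Y - c) / m - (- Y - c) / m = 2 * Y / m"
      using m0 by (simp add: field_simps)
    ultimately have "real_of_int (B - A + 1) \<le> 2 * Y / m + 1" by simp
    moreover have "2 * Y / m + 1 \<ge> 0" using assms by auto
    ultimately show ?thesis by simp
  qed
  ultimately show "real (card ?S) \<le> 2 * Y / m + 1" by linarith
qed

text \<open>The vectors (u, v) that \<open>dual_root\<close> can produce for given m and s when n <=
  X: the norm is m n <= m X, and the congruence comes from s v - u = m v'.\<close>

definition ellipse_points :: "int \<Rightarrow> int \<Rightarrow> int \<Rightarrow> int \<Rightarrow> (int \<times> int) set" where
  "ellipse_points d X m s = {(u, v). u\<^sup>2 + d * v\<^sup>2 \<le> m * X \<and> m dvd u - s * v}"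

text \<open>The ellipse has area of order m X / sqrt d and the lattice has index m, so the quotient
  is free of m and s. The ellipse is enclosed in a box with half-sides U and V; m <= X gives m <= U
  and d <= X gives 1 <= V, which absorbs the boundary terms.\<close>

lemma card_ellipse_points_le:
  fixes d X m s :: int
  assumes "m \<ge> 1" "d \<ge> 1" "m \<le> X" "d \<le> X"
  shows "finite (ellipse_points d X m s)" "real (card (ellipse_points d X m s)) \<le> 9 * X / sqrt d"
proof -
  define U where "U = sqrt (m * X)"
  define V where "V = sqrt (m * X / d)"
  \<comment> \<open>Written with the trivial modulus 1 so that \<open>card_multiples_le\<close> also
    counts the values of v.\<close>
  define T where "T = {v::int. \<bar>real_of_int v\<bar> \<le> V \<and> 1 dvd v - 0}"
  define S where "S = (\<lambda>v::int. {u::int. \<bar>real_of_int u\<bar> \<le> U \<and> m dvd u - s * v})"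
  have pos: "real_of_int m > 0" "real_of_int d > 0" "real_of_int X > 0" using assms by auto
  have U0: "U \<ge> 0" and V0: "V \<ge> 0" using pos by (auto simp: U_def V_def)
  have finT: "finite T" and cT: "real (card T) \<le> 2 * V + 1"
    using card_multiples_le[of 1 V 0] V0 unfolding T_def by auto
  have finS: "finite (S v)" and cS: "real (card (S v)) \<le> 2 * U / m + 1" for v
    using card_multiples_le[of m U "s * v"] U0 assms(1) unfolding S_def by auto
  have sub: "ellipse_points d X m s \<subseteq> (\<lambda>(v, u). (u, v)) ` Sigma T S"
  proof
    fix z assume "z \<in> ellipse_points d X m s"
    then obtain u v where z: "z = (u, v)" "u\<^sup>2 + d * v\<^sup>2 \<le> m * X" "m dvd u - s * v"
      by (auto simp: ellipse_points_def)
    from z(2) have r: "(real_of_int u)\<^sup>2 + d * (real_of_int v)\<^sup>2 \<le> real_of_int m * X"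
      by (metis of_int_add of_int_le_iff of_int_mult of_int_power)
    have "d * (real_of_int v)\<^sup>2 \<ge> 0" using pos by simp
    then have "(real_of_int u)\<^sup>2 \<le> real_of_int m * X" using r by linarith
    then have "\<bar>real_of_int u\<bar> \<le> U" unfolding U_def by (simp add: real_le_rsqrt)
    moreover have "d * (real_of_int v)\<^sup>2 \<le> real_of_int m * X" using r zero_le_power2[of "real_of_int u"] by linarith
    then have "(real_of_int v)\<^sup>2 \<le> real_of_int m * X / d" using pos by (simp add: field_simps)
    then have "\<bar>real_of_int v\<bar> \<le> V" unfolding V_def by (simp add: real_le_rsqrt)
    ultimately have "(v, u) \<in> Sigma T S" using z by (auto simp: T_def S_def)
    then show "z \<in> (\<lambda>(v, u). (u, v)) ` Sigma T S" using z(1) by force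
  qed
  have finTS: "finite (Sigma T S)" using finT finS by auto
  show "finite (ellipse_points d X m s)" using sub finTS by (meson finite_imageI finite_subset)
  have "card (ellipse_points d X m s) \<le> card (Sigma T S)"
    using sub finTS by (meson card_image_le card_mono finite_imageI le_trans)
  then have "real (card (ellipse_points d X m s)) \<le> (\<Sum>v\<in>T. real (card (S v)))"
    using finT finS by (simp add: card_SigmaI flip: of_nat_sum)
  also have "\<dots> \<le> (\<Sum>v\<in>T. 2 * U / m + 1)" by (intro sum_mono cS)
  also have "\<dots> = card T * (2 * U / m + 1)" by simp
  also have "\<dots> \<le> (2 * V + 1) * (2 * U / m + 1)"
    using cT U0 pos by (intro mult_right_mono) auto
  also have "\<dots> \<le> (3 * V) * (3 * (U / m))"
  proof (intro mult_mono)
    have "real_of_int d * 1 \<le> real_of_int X * real_of_int m" using assms by (intro mult_mono) auto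
    then have "1 \<le> real_of_int m * X / d" using pos by (simp add: field_simps)
    then have "1 \<le> V" unfolding V_def by simp
    then show "2 * V + 1 \<le> 3 * V" by simp
    have "real_of_int m * m \<le> real_of_int m * X" using assms pos by simp
    then have "m \<le> U" unfolding U_def by (intro real_le_rsqrt) (simp add: power2_eq_square)
    then show "2 * U / m + 1 \<le> 3 * (U / m)" using pos by (simp add: field_simps)
  qed (use U0 V0 pos in auto)
  also have "\<dots> = 9 * (U * V) / m" by simp
  also have "U * V = m * X / sqrt d"
    unfolding U_def V_def using pos by (simp add: real_sqrt_divide)
  finally show "real (card (ellipse_points d X m s)) \<le> 9 * X / sqrt d" using pos by simp
qed

text \<open>Moduli up to X are traded for moduli up to 2 sqrt d: by \<open>dual_root\<close> each
  pair (n, t) has a code (m, s, u, v), and each (m, s) admits O(X / sqrt d) vectors. The assumption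
  on X gives m <= 2 sqrt d <= 2 d <= X, as the ellipse bound requires.\<close>

lemma sum_card_neg_sqroots_le:
  fixes d X :: int
  assumes d: "d \<ge> 1" and X: "2 * d \<le> X"
  shows "(\<Sum>n=1..X. real (card (neg_sqroots d n)))
    \<le> 9 * X / sqrt d * (\<Sum>m=1..\<lfloor>2 * sqrt d\<rfloor>. real (card (neg_sqroots d m)))"
proof -
  define A where "A = Sigma {1..X} (neg_sqroots d)"
  define M where "M = \<lfloor>2 * sqrt d\<rfloor>"
  define B where "B = Sigma {1..M} (\<lambda>m. Sigma (neg_sqroots d m) (ellipse_points d X m))"
  have "sqrt d \<le> d" using d real_le_lsqrt[of d d] by (simp add: power2_eq_square)
  then have MX: "M \<le> X" using X unfolding M_def by linarith
  have ell: "finite (ellipse_points d X m s)" "real (card (ellipse_points d X m s)) \<le> 9 * X / sqrt d"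
    if "m \<in> {1..M}" for m s
    using card_ellipse_points_le[of m d X s] that d X MX by auto
  have finB: "finite B" unfolding B_def using ell by (intro finite_SigmaI) auto
  \<comment> \<open>A code determines n because m is nonzero, and it determines u' and v' by their
    defining equations, so these need not be part of it.\<close>
  define R where "R = (\<lambda>(n, t) (m, s, u, v). m \<noteq> 0 \<and> m * n = u\<^sup>2 + d * v\<^sup>2 \<and>
     (\<exists>v' u'. s * v - u = m * v' \<and> s * u + d * v = m * u' \<and> coprime v v' \<and>
       n dvd t * v - u \<and> n dvd t * v' - u'))"
  have "card A \<le> card B"
  proof (rule card_le_card_if_rel[where R = R, OF finB])
    fix x assume "x \<in> A"
    then obtain n t where x: "x = (n, t)" "1 \<le> n" "n \<le> X" "n dvd t\<^sup>2 + d"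
      by (auto simp: A_def neg_sqroots_def)
    obtain m s u v v' u' where m: "m \<ge> 1" "real_of_int m \<le> 2 * sqrt d" "s \<in> neg_sqroots d m"
      "m * n = u\<^sup>2 + d * v\<^sup>2" "s * v - u = m * v'" "s * u + d * v = m * u'"
      "coprime v v'" "n dvd t * v - u" "n dvd t * v' - u'"
      using dual_root[OF x(2) d x(4)] by blast
    have "m \<in> {1..M}" using m by (auto simp: M_def le_floor_iff)
    moreover have "u\<^sup>2 + d * v\<^sup>2 \<le> m * X" unfolding m(4)[symmetric] using m(1) x by simp
    moreover have "m dvd u - s * v" using m(5) by (metis dvd_minus_iff dvd_triv_left minus_diff_eq)
    ultimately have "(m, s, u, v) \<in> B" using m(3) by (simp add: B_def ellipse_points_def)
    moreover have "R x (m, s, u, v)" unfolding R_def x using m by auto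
    ultimately show "\<exists>y\<in>B. R x y" by blast
  next
    fix x x' y assume "x \<in> A" "x' \<in> A" "R x y" "R x' y"
    obtain n t n' t' m s u v where e: "x = (n, t)" "x' = (n', t')" "y = (m, s, u, v)"
      by (metis surj_pair)
    from \<open>R x y\<close> obtain v1 u1 where 1: "m * n = u\<^sup>2 + d * v\<^sup>2" "s * v - u = m * v1"
      "s * u + d * v = m * u1" "coprime v v1" "n dvd t * v - u" "n dvd t * v1 - u1"
      unfolding R_def e by auto
    from \<open>R x' y\<close> obtain v2 u2 where 2: "m * n' = u\<^sup>2 + d * v\<^sup>2" "s * v - u = m * v2"
      "s * u + d * v = m * u2" "n' dvd t' * v - u" "n' dvd t' * v2 - u2"
      unfolding R_def e by auto
    have nt: "n \<ge> 1" "0 \<le> t" "t < n" "0 \<le> t'" "t' < n'"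
      using \<open>x \<in> A\<close> \<open>x' \<in> A\<close> by (auto simp: A_def e neg_sqroots_def)
    have "m \<noteq> 0" using \<open>R x y\<close> unfolding R_def e by auto
    moreover have "m * n' = m * n" using 1(1) 2(1) by simp
    ultimately have "n' = n" by (metis mult_cancel_left)
    with \<open>m \<noteq> 0\<close> have [simp]: "n' = n" "v2 = v1" "u2 = u1" using 1(1-3) 2(1-3) by auto
    \<comment> \<open>Both v and v' carry t - t' to 0 modulo n; since they are coprime, t - t'
      itself vanishes modulo n.\<close>
    have "n dvd (t - t') * v" "n dvd (t - t') * v1"
      using dvd_diff[OF 1(5) 2(4)[simplified]] dvd_diff[OF 1(6) 2(5)[simplified]]
      by (simp_all add: algebra_simps)
    then have "n dvd gcd ((t - t') * v) ((t - t') * v1)" by simp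
    then have "n dvd t - t'" using 1(4) by (simp add: gcd_mult_left)
    then have "t = t'" using nt zdvd_imp_le[of n "\<bar>t - t'\<bar>"] by (cases "t = t'") auto
    then show "x = x'" by (simp add: e)
  qed
  moreover have "(\<Sum>n=1..X. real (card (neg_sqroots d n))) = card A"
    unfolding A_def by (subst card_SigmaI) auto
  moreover have "real (card B) \<le> 9 * X / sqrt d * (\<Sum>m=1..M. real (card (neg_sqroots d m)))"
  proof -
    have "real (card B) = (\<Sum>m=1..M. \<Sum>s\<in>neg_sqroots d m. real (card (ellipse_points d X m s)))"
      unfolding B_def using ell by (subst card_SigmaI) (auto intro!: sum.cong simp: card_SigmaI)
    also have "\<dots> \<le> (\<Sum>m=1..M. \<Sum>s\<in>neg_sqroots d m. 9 * X / sqrt d)"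
      using ell by (intro sum_mono) auto
    also have "\<dots> = 9 * X / sqrt d * (\<Sum>m=1..M. real (card (neg_sqroots d m)))"
      unfolding sum_distrib_left by (intro sum.cong) auto
    finally show ?thesis .
  qed
  ultimately show ?thesis unfolding M_def by linarith
qed

section \<open>Averaging over $d$\<close>

lemma sum_inverse_sqrt_le: "(\<Sum>j=1..J. 1 / sqrt (real j)) \<le> 2 * sqrt J"
proof (induction J)
  case (Suc J)
  have a: "sqrt (real (Suc J)) > 0" "sqrt (real J) \<ge> 0" "sqrt (real J) \<le> sqrt (real (Suc J))" by auto
  have "(sqrt (real (Suc J)) - sqrt J) * (sqrt (real (Suc J)) + sqrt J) = 1"
    by (simp add: algebra_simps)
  then have "1 \<le> (sqrt (real (Suc J)) - sqrt J) * (2 * sqrt (real (Suc J)))"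
    using a by (metis add_left_mono diff_ge_0_iff_ge mult_2 mult_left_mono)
  then have "1 / sqrt (real (Suc J)) \<le> 2 * (sqrt (real (Suc J)) - sqrt J)"
    using a by (simp add: field_simps)
  then show ?case using Suc by simp
qed simp

text \<open>This is the inner sum after m is fixed and the summation is over d: m <= 2 sqrt d reads
  m^2 <= 4 d, and a root s of -d modulo m confines d to the class of -s^2. The lower bound on d
  tames the one term with d < m.\<close>

lemma sum_inverse_sqrt_residue_class_le:
  fixes m D c :: int
  assumes "m \<ge> 1" and D: "D \<ge> 1"
  shows "(\<Sum>d\<in>{d\<in>{1..D}. m\<^sup>2 \<le> 4 * d \<and> m dvd c + d}. 1 / sqrt d) \<le> 2 / m + 2 * sqrt D / m"
proof -
  define S where "S = {d\<in>{1..D}. m\<^sup>2 \<le> 4 * d \<and> m dvd c + d}"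
  define J where "J = nat (D div m)"
  \<comment> \<open>The terms are indexed by \<open>j = d div m\<close>: use \<open>m\<^sup>2 \<le> 4 * d\<close> if \<open>j = 0\<close>, and \<open>j * m \<le> d\<close> otherwise.\<close>
  define g where "g = (\<lambda>j::nat. if j = 0 then 2 / real_of_int m else 1 / sqrt m * (1 / sqrt j))"
  define \<phi> where "\<phi> = (\<lambda>d. nat (d div m))"
  have m0: "real_of_int m > 0" using assms by simp
  have inj: "inj_on \<phi> S"
  proof
    fix d d' assume d: "d \<in> S" "d' \<in> S" "\<phi> d = \<phi> d'"
    then have "m dvd (c + d) - (c + d')" unfolding S_def by (blast intro: dvd_diff)
    then have "d mod m = d' mod m" by (simp add: mod_eq_dvd_iff)
    moreover have "d div m \<ge> 0" "d' div m \<ge> 0"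
      using d assms by (auto simp: S_def pos_imp_zdiv_nonneg_iff)
    then have "d div m = d' div m" using d(3) unfolding \<phi>_def by simp
    ultimately show "d = d'" by (metis mult_div_mod_eq)
  qed
  have le: "1 / sqrt d \<le> g (\<phi> d)" if "d \<in> S" for d
  proof -
    have d: "1 \<le> d" "m\<^sup>2 \<le> 4 * d" using that by (auto simp: S_def)
    then have q0: "d div m \<ge> 0" using assms by (auto simp: pos_imp_zdiv_nonneg_iff)
    show ?thesis
    proof (cases "\<phi> d = 0")
      case True
      have "(real_of_int m)\<^sup>2 \<le> 4 * real_of_int d" using d(2)
        by (metis of_int_le_iff of_int_mult of_int_numeral of_int_power)
      then have "real_of_int m \<le> sqrt (4 * real_of_int d)" by (rule real_le_rsqrt)
      then have "m \<le> 2 * sqrt d" by (simp add: real_sqrt_mult)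
      then show ?thesis using True d m0 by (simp add: g_def field_simps)
    next
      case False
      have "m * (d div m) + d mod m = d" "d mod m \<ge> 0" using assms by auto
      then have "m * (d div m) \<le> d" by linarith
      then have "real_of_int m * real (\<phi> d) \<le> d" using q0 unfolding \<phi>_def
        by (simp flip: of_int_mult)
      then have "sqrt m * sqrt (\<phi> d) \<le> sqrt d" by (simp flip: real_sqrt_mult)
      moreover have "sqrt m * sqrt (\<phi> d) > 0" using False m0 by simp
      ultimately show ?thesis using False by (simp add: g_def frac_le flip: times_divide_times_eq)
    qed
  qed
  have "\<phi> ` S \<subseteq> {0..J}"
    using assms by (auto simp: \<phi>_def J_def S_def intro!: nat_mono zdiv_mono1)
  have "(\<Sum>d\<in>S. 1 / sqrt d) \<le> (\<Sum>d\<in>S. g (\<phi> d))" by (intro sum_mono le)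
  also have "\<dots> = (\<Sum>j\<in>\<phi> ` S. g j)" using inj by (simp add: sum.reindex)
  also have "\<dots> \<le> (\<Sum>j\<in>{0..J}. g j)"
    using \<open>\<phi> ` S \<subseteq> {0..J}\<close> m0 by (intro sum_mono2) (auto simp: g_def)
  also have "\<dots> = g 0 + (\<Sum>j=1..J. g j)" by (simp add: sum.atLeast_Suc_atMost)
  also have "(\<Sum>j=1..J. g j) \<le> 2 * sqrt D / m"
  proof -
    have "real J = real_of_int (D div m)" using D assms by (simp add: J_def pos_imp_zdiv_nonneg_iff)
    also have "\<dots> \<le> D / m" by (metis of_int_floor_le floor_divide_of_int_eq)
    finally have J: "sqrt J \<le> sqrt (D / m)" by simp
    have "(\<Sum>j=1..J. g j) = 1 / sqrt m * (\<Sum>j=1..J. 1 / sqrt j)"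
      unfolding sum_distrib_left by (intro sum.cong) (auto simp: g_def)
    also have "\<dots> \<le> 1 / sqrt m * (2 * sqrt (D / m))"
      using m0 order_trans[OF sum_inverse_sqrt_le[of J] mult_left_mono[OF J, of 2]]
      by (intro mult_left_mono) simp_all
    also have "\<dots> = 2 * sqrt D / m" using m0 by (simp add: real_sqrt_divide)
    finally show ?thesis .
  qed
  finally show ?thesis unfolding S_def by (simp add: g_def)
qed

text \<open>Swap the order of summation. For each m, the m residues s contribute at most (2 + 2 sqrt
  D) / m each, so every m costs 2 + 2 sqrt D, and there are at most 2 sqrt D values of m. The weight
  1 / sqrt d is the one left by \<open>sum_card_neg_sqroots_le\<close>.\<close>

lemma sum_sum_card_neg_sqroots_le:
  fixes D :: int
  assumes "D \<ge> 1"
  shows "(\<Sum>d=1..D. 1 / sqrt d * (\<Sum>m=1..\<lfloor>2 * sqrt d\<rfloor>. real (card (neg_sqroots d m)))) \<le> 8 * D"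
proof -
  define M where "M = \<lfloor>2 * sqrt D\<rfloor>"
  have D1: "sqrt D \<ge> 1" using assms by simp
  have inner: "(\<Sum>m=1..\<lfloor>2 * sqrt d\<rfloor>. real (card (neg_sqroots d m)))
     = (\<Sum>m=1..M. \<Sum>s\<in>{0..<m}. if m\<^sup>2 \<le> 4 * d \<and> m dvd s\<^sup>2 + d then 1 else 0)" if "d \<in> {1..D}" for d
  proof -
    have iff: "m \<le> \<lfloor>2 * sqrt d\<rfloor> \<longleftrightarrow> m\<^sup>2 \<le> 4 * d" if "m \<ge> 1" for m :: int
    proof -
      have "m \<le> \<lfloor>2 * sqrt d\<rfloor> \<longleftrightarrow> sqrt ((real_of_int m)\<^sup>2) \<le> sqrt (4 * real_of_int d)"
        using that by (simp add: le_floor_iff real_sqrt_mult)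
      also have "\<dots> \<longleftrightarrow> real_of_int (m\<^sup>2) \<le> real_of_int (4 * d)"
        by (subst real_sqrt_le_iff) simp
      finally show ?thesis by (simp only: of_int_le_iff)
    qed
    have "\<lfloor>2 * sqrt d\<rfloor> \<le> M" using that unfolding M_def by (intro floor_mono) auto
    then have "{1..\<lfloor>2 * sqrt d\<rfloor>} = {m\<in>{1..M}. m\<^sup>2 \<le> 4 * d}" using iff by auto
    then have "(\<Sum>m=1..\<lfloor>2 * sqrt d\<rfloor>. real (card (neg_sqroots d m)))
      = (\<Sum>m=1..M. if m\<^sup>2 \<le> 4 * d then real (card (neg_sqroots d m)) else 0)"
      by (simp only: sum.inter_filter[OF finite_atLeastAtMost_int])
    also have "\<dots> = (\<Sum>m=1..M. \<Sum>s\<in>{0..<m}. if m\<^sup>2 \<le> 4 * d \<and> m dvd s\<^sup>2 + d then 1 else 0)"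
    proof (intro sum.cong refl)
      fix m
      have "real (card (neg_sqroots d m)) = (\<Sum>s\<in>{s\<in>{0..<m}. m dvd s\<^sup>2 + d}. 1)" by (simp add: neg_sqroots_def)
      also have "\<dots> = (\<Sum>s\<in>{0..<m}. if m dvd s\<^sup>2 + d then 1 else 0)" by (subst sum.inter_filter) auto
      finally show "(if m\<^sup>2 \<le> 4 * d then real (card (neg_sqroots d m)) else 0)
        = (\<Sum>s\<in>{0..<m}. if m\<^sup>2 \<le> 4 * d \<and> m dvd s\<^sup>2 + d then 1 else 0)" by auto
    qed
    finally show ?thesis .
  qed
  have "(\<Sum>d=1..D. 1 / sqrt d * (\<Sum>m=1..\<lfloor>2 * sqrt d\<rfloor>. real (card (neg_sqroots d m))))
    = (\<Sum>d=1..D. \<Sum>m=1..M. \<Sum>s\<in>{0..<m}. if m\<^sup>2 \<le> 4 * d \<and> m dvd s\<^sup>2 + d then 1 / sqrt d else 0)"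
    using inner by (intro sum.cong refl) (simp add: sum_distrib_left if_distrib cong: if_cong)
  also have "\<dots> = (\<Sum>m=1..M. \<Sum>d=1..D. \<Sum>s\<in>{0..<m}. if m\<^sup>2 \<le> 4 * d \<and> m dvd s\<^sup>2 + d then 1 / sqrt d else 0)"
    by (rule sum.swap)
  also have "\<dots> = (\<Sum>m=1..M. \<Sum>s\<in>{0..<m}. \<Sum>d=1..D. if m\<^sup>2 \<le> 4 * d \<and> m dvd s\<^sup>2 + d then 1 / sqrt d else 0)"
    by (intro sum.cong refl sum.swap)
  also have "\<dots> \<le> (\<Sum>m=1..M. \<Sum>s\<in>{0..<m}. 2 / m + 2 * sqrt D / m)"
  proof (intro sum_mono)
    fix m s assume "m \<in> {1..M}"
    then show "(\<Sum>d=1..D. if m\<^sup>2 \<le> 4 * d \<and> m dvd s\<^sup>2 + d then 1 / sqrt d else 0) \<le> 2 / m + 2 * sqrt D / m"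
      using sum_inverse_sqrt_residue_class_le[of m D "s\<^sup>2"] assms
      unfolding sum.inter_filter[OF finite_atLeastAtMost_int] by simp
  qed
  also have "\<dots> = (\<Sum>m=1..M. 2 + 2 * sqrt D)"
    by (intro sum.cong refl) (auto simp: field_simps)
  also have "\<dots> = M * (2 + 2 * sqrt D)" using D1 by (simp add: M_def)
  also have "\<dots> \<le> (2 * sqrt D) * (4 * sqrt D)"
    using D1 by (intro mult_mono) (auto simp: M_def)
  also have "\<dots> = 8 * D" using assms by simp
  finally show ?thesis .
qed

section \<open>Counting roots by the Chinese remainder theorem\<close>

text \<open>The roots y and -y modulo p are distinct because p is odd and divides neither d nor,
  therefore, y. The Chinese remainder theorem glues each of them to every root modulo n.\<close>

lemma card_neg_sqroots_prime_mult:
  fixes d n p y :: int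
  assumes "n \<ge> 1" "prime p" "odd p" "\<not> p dvd d" "coprime n p" "p dvd y\<^sup>2 + d"
  shows "2 * card (neg_sqroots d n) \<le> card (neg_sqroots d (n * p))"
proof -
  have p0: "p > 0" using assms(2) by (simp add: prime_gt_0_int)
  define Y where "Y = {y mod p, (- y) mod p}"
  have py: "\<not> p dvd y" using assms(4,6) by (metis dvd_add_right_iff dvd_mult power2_eq_square)
  have "y mod p \<noteq> (- y) mod p"
  proof
    assume "y mod p = (- y) mod p"
    then have "p dvd 2 * y" by (simp add: mod_eq_dvd_iff)
    then have "p dvd 2" using py assms(2) by (simp add: prime_dvd_mult_iff)
    then have "p = 2" using assms(2) by (metis primes_dvd_imp_eq two_is_prime)
    then show False using assms(3) by simp
  qed
  then have cY: "card Y = 2" by (simp add: Y_def)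
  have Yd: "p dvd z\<^sup>2 + d \<and> 0 \<le> z \<and> z < p" if "z \<in> Y" for z
  proof -
    have "z\<^sup>2 mod p = y\<^sup>2 mod p" using that by (auto simp: Y_def power_mod)
    then have "p dvd z\<^sup>2 - y\<^sup>2" by (simp add: mod_eq_dvd_iff)
    then have "p dvd (z\<^sup>2 - y\<^sup>2) + (y\<^sup>2 + d)" using assms(6) by (rule dvd_add)
    then show ?thesis using that p0 by (auto simp: Y_def)
  qed
  define R where "R = (\<lambda>(t, z) x. x mod n = t \<and> x mod p = (z :: int))"
  have "card (neg_sqroots d n \<times> Y) \<le> card (neg_sqroots d (n * p))"
  proof (rule card_le_card_if_rel[where R = R])
    fix x assume "x \<in> neg_sqroots d n \<times> Y"
    then obtain t z where x: "x = (t, z)" "t \<in> neg_sqroots d n" "z \<in> Y" by auto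
    obtain a where a: "[a = t] (mod n)" "[a = z] (mod p)"
      using binary_chinese_remainder_int[OF assms(5)] by blast
    define b where "b = a mod (n * p)"
    have b: "b mod n = t" "b mod p = z"
      using a x(2) Yd[OF x(3)]
      by (simp_all add: b_def Cong.cong_def neg_sqroots_def mod_mod_cancel mod_pos_pos_trivial)
    have "n dvd t\<^sup>2 + d" using x(2) by (simp add: neg_sqroots_def)
    then have "n dvd b\<^sup>2 + d" using b(1) by (metis dvd_eq_mod_eq_0 mod_add_left_eq power_mod)
    moreover have "p dvd b\<^sup>2 + d" using b(2) Yd[OF x(3)] by (metis dvd_eq_mod_eq_0 mod_add_left_eq power_mod)
    ultimately have "n * p dvd b\<^sup>2 + d" using assms(5) by (simp add: divides_mult)
    then have "b \<in> neg_sqroots d (n * p)" using assms(1) p0 by (simp add: neg_sqroots_def b_def)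
    then show "\<exists>y\<in>neg_sqroots d (n * p). R x y" using b by (auto simp: R_def x)
  qed (auto simp: R_def)
  then show ?thesis by (simp add: card_cartesian_product cY)
qed

lemma two_power_le_card_neg_sqroots:
  fixes d :: int and S :: "nat set"
  assumes "finite S"
    "\<And>p. p \<in> S \<Longrightarrow> prime p \<and> odd p \<and> \<not> int p dvd d \<and> (\<exists>y. int p dvd y\<^sup>2 + d)"
  shows "2 ^ card S \<le> card (neg_sqroots d (int (\<Prod>S)))"
  using assms
proof (induction S rule: finite_induct)
  case empty
  have "neg_sqroots d 1 = {0}" by (auto simp: neg_sqroots_def)
  then show ?case by simp
next
  case (insert p S)
  then obtain y where p: "prime p" "odd p" "\<not> int p dvd d" "int p dvd y\<^sup>2 + d" by blast
  have "coprime (\<Prod>S) p"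
    using insert p by (intro prod_coprime_left) (auto intro!: primes_coprime)
  then have "coprime (int (\<Prod>S)) (int p)" by (simp only: coprime_int_iff)
  moreover have "\<Prod>S > 0" using insert.prems by (intro prod_pos) (auto simp: prime_gt_0_nat)
  then have "int (\<Prod>S) \<ge> 1" by linarith
  ultimately have "2 * card (neg_sqroots d (int (\<Prod>S))) \<le> card (neg_sqroots d (int (\<Prod>S) * int p))"
    using p by (intro card_neg_sqroots_prime_mult[where y = y]) auto
  moreover have "int (\<Prod>S) * int p = int (\<Prod>(insert p S))" using insert by simp
  moreover have "2 ^ card S \<le> card (neg_sqroots d (int (\<Prod>S)))" using insert by simp
  ultimately show ?case using insert.hyps by (simp add: mult.commute)
qed

section \<open>The Euler product over the cofactors\<close>

lemma bigomega_mult: "a \<noteq> 0 \<Longrightarrow> b \<noteq> 0 \<Longrightarrow> bigomega (a * b) = bigomega a + bigomega b"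
  by (simp add: bigomega_def prime_factorization_mult)

lemma bigomega_prod_primes:
  assumes "finite S" "\<And>p. p \<in> S \<Longrightarrow> prime p"
  shows "bigomega (\<Prod>S) = card S"
  using assms
proof (induction S rule: finite_induct)
  case (insert p S)
  have "prime p" using insert by simp
  then have "bigomega p = 1" by (simp add: bigomega_def prime_factorization_prime)
  moreover have "\<Prod>S \<noteq> 0" using insert by (metis insertI2 not_prime_0 prod_zero_iff)
  ultimately show ?case using insert by (simp add: bigomega_mult prime_gt_0_nat)
qed (simp add: bigomega_def)

lemma bigomega_eq_sum:
  assumes "finite P" "prime_factors e \<subseteq> P"
  shows "bigomega e = (\<Sum>p\<in>P. count (prime_factorization e) p)"
  unfolding bigomega_def using assms
  by (auto simp: size_multiset_overloaded_eq intro!: sum.mono_neutral_left simp: not_in_iff)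

text \<open>The left side is completely multiplicative in e. A prime of P not dividing e contributes
  1, so a single P can serve many e at once.\<close>

lemma two_power_bigomega_div_eq:
  assumes "finite P" "prime_factors e \<subseteq> P" "e > 0" "\<And>p. p \<in> P \<Longrightarrow> prime p"
  shows "2 ^ bigomega e / real e = (\<Prod>p\<in>P. (2 / real p) ^ multiplicity p e)"
proof -
  have "bigomega e = (\<Sum>p\<in>P. multiplicity p e)"
    using assms by (simp add: bigomega_eq_sum count_prime_factorization)
  moreover have "e = (\<Prod>p\<in>P. p ^ multiplicity p e)"
  proof -
    have "e = (\<Prod>p\<in>prime_factors e. p ^ multiplicity p e)" using assms by (intro prime_factorization_nat)
    also have "\<dots> = (\<Prod>p\<in>P. p ^ multiplicity p e)"
      using assms by (intro prod.mono_neutral_left) (auto simp: prime_factors_multiplicity)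
    finally show ?thesis .
  qed
  then have "real e = (\<Prod>p\<in>P. real p ^ multiplicity p e)" by (metis (no_types, lifting) of_nat_power of_nat_prod prod.cong)
  ultimately show ?thesis by (simp add: power_sum power_divide prod_dividef)
qed

text \<open>Unique factorization embeds E into the exponent functions in \<open>PiE P A\<close>, and
  expanding the product on the right gives one nonnegative term for each such function.\<close>

lemma sum_le_euler_product:
  fixes h :: "nat \<Rightarrow> nat \<Rightarrow> real"
  assumes "finite P" "\<And>p. p \<in> P \<Longrightarrow> finite (A p)" "\<And>p a. h p a \<ge> 0"
    "\<And>e. e \<in> E \<Longrightarrow> e > 0 \<and> prime_factors e \<subseteq> P \<and> (\<forall>p\<in>P. multiplicity p e \<in> A p)"
  shows "(\<Sum>e\<in>E. \<Prod>p\<in>P. h p (multiplicity p e)) \<le> (\<Prod>p\<in>P. \<Sum>a\<in>A p. h p a)"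
proof -
  define \<psi> where "\<psi> = (\<lambda>e. \<lambda>p\<in>P. multiplicity p e)"
  have "inj_on \<psi> E"
  proof
    fix e e' assume e: "e \<in> E" "e' \<in> E" "\<psi> e = \<psi> e'"
    have "multiplicity p e = multiplicity p e'" if "prime p" for p
    proof (cases "p \<in> P")
      case True
      then show ?thesis using e(3) unfolding \<psi>_def by (metis restrict_apply')
    next
      case False
      then have "p \<notin> prime_factors e" "p \<notin> prime_factors e'" using assms(4) e by blast+
      then show ?thesis using that by (simp add: prime_factors_multiplicity)
    qed
    moreover have "e > 0" "e' > 0" using assms(4) e by blast+
    ultimately show "e = e'" using multiplicity_eq_nat[of e e'] by blast
  qed
  have "(\<Sum>e\<in>E. \<Prod>p\<in>P. h p (multiplicity p e)) = (\<Sum>e\<in>E. \<Prod>p\<in>P. h p (\<psi> e p))"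
    by (simp add: \<psi>_def)
  also have "\<dots> = (\<Sum>g\<in>\<psi> ` E. \<Prod>p\<in>P. h p (g p))"
    using \<open>inj_on \<psi> E\<close> by (simp add: sum.reindex)
  also have "\<dots> \<le> (\<Sum>g\<in>PiE P A. \<Prod>p\<in>P. h p (g p))"
    using assms by (intro sum_mono2 finite_PiE prod_nonneg) (auto simp: \<psi>_def)
  also have "\<dots> = (\<Prod>p\<in>P. \<Sum>a\<in>A p. h p a)"
    using assms by (subst prod_sum_PiE) auto
  finally show ?thesis .
qed

section \<open>Elementary bounds for the local factors\<close>

lemma prod_odd_ratio_le:
  fixes S :: "nat set"
  assumes "finite S" "\<And>p. p \<in> S \<Longrightarrow> odd p \<and> p \<ge> 3"
  shows "(\<Prod>p\<in>S. real p / (real p - 2)) \<le> 2 * card S + 1"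
  using assms
proof (induction S rule: finite_linorder_max_induct)
  case (insert b S)
  define c where "c = (b - 3) div 2"
  have bS: "b \<notin> S" using insert.hyps(2) by blast
  have b: "b = 2 * c + 3" using insert.prems[of b] unfolding c_def by (auto elim!: oddE)
  \<comment> \<open>The \<open>i\<close>-th smallest element is at least \<open>2 * i + 1\<close>, so the product is dominated by a telescoping one.\<close>
  have "S \<subseteq> (\<lambda>i. 2 * i + 3) ` {..<c}"
  proof
    fix p assume p: "p \<in> S"
    then have "odd p" "p \<ge> 3" "p < b" using insert by auto
    then have "p = 2 * ((p - 3) div 2) + 3" "(p - 3) div 2 < c" using b by (auto elim!: oddE)
    then show "p \<in> (\<lambda>i. 2 * i + 3) ` {..<c}" by blast
  qed
  then have "card S \<le> card {..<c}" by (meson card_image_le card_mono finite_imageI finite_lessThan le_trans)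
  then have sc: "real (card S) \<le> real c" by simp
  have "(\<Prod>p\<in>insert b S. real p / (real p - 2)) = real b / (real b - 2) * (\<Prod>p\<in>S. real p / (real p - 2))"
    using bS insert.hyps(1) by simp
  also have "\<dots> \<le> (2 * card S + 3) / (2 * card S + 1) * (2 * card S + 1)"
  proof (intro mult_mono)
    show "real b / (real b - 2) \<le> real (2 * card S + 3) / real (2 * card S + 1)"
      using sc unfolding b by (simp add: divide_simps) (simp add: algebra_simps)
    show "(\<Prod>p\<in>S. real p / (real p - 2)) \<le> real (2 * card S + 1)" using insert by auto
    show "(\<Prod>p\<in>S. real p / (real p - 2)) \<ge> 0"
      using insert.prems by (intro prod_nonneg divide_nonneg_nonneg) force+
  qed auto
  also have "\<dots> = real (2 * card S + 3)" by simp
  also have "2 * card S + 3 = 2 * card (insert b S) + 1" using bS insert.hyps(1) by simp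
  finally show ?case .
qed simp

text \<open>Over all integers p >= 3 the terms 2 / (p - 2) - 2 / p telescope with gap two, leaving
  2/1 + 2/2 = 3.\<close>

lemma sum_four_div_le:
  fixes S :: "nat set"
  assumes "finite S" "\<And>p. p \<in> S \<Longrightarrow> p \<ge> 3"
  shows "(\<Sum>p\<in>S. 4 / (real p * (real p - 2))) \<le> 3"
proof -
  have *: "(\<Sum>j<n. 4 / (real (j + 3) * (real (j + 3) - 2))) = 3 - 2 / (real n + 1) - 2 / (real n + 2)" for n
  proof (induction n)
    case (Suc n)
    have "4 / (real (n + 3) * (real (n + 3) - 2)) = 2 / (real n + 1) - 2 / (real n + 3)"
      by (simp add: divide_simps) 
    then show ?case using Suc by (simp add: algebra_simps)
  qed simp
  obtain n where n: "\<And>p. p \<in> S \<Longrightarrow> p < n" 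
    using finite_nat_set_iff_bounded[THEN iffD1, OF assms(1)] by blast
  have "S \<subseteq> (\<lambda>j. j + 3) ` {..<n}"
  proof
    fix p assume "p \<in> S"
    then have "p = (p - 3) + 3" "p - 3 < n" using assms(2)[of p] n[of p] by auto
    then show "p \<in> (\<lambda>j. j + 3) ` {..<n}" by blast
  qed
  then have "(\<Sum>p\<in>S. 4 / (real p * (real p - 2))) \<le> (\<Sum>p\<in>(\<lambda>j. j + 3) ` {..<n}. 4 / (real p * (real p - 2)))"
    by (intro sum_mono2) auto
  also have "\<dots> = (\<Sum>j<n. 4 / (real (j + 3) * (real (j + 3) - 2)))"
    by (subst sum.reindex) auto
  also have "\<dots> \<le> 3"
  proof -
    have "2 / (real n + 1) \<ge> 0" "2 / (real n + 2) \<ge> 0" by simp_all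
    then show ?thesis unfolding * by linarith
  qed
  finally show ?thesis .
qed

lemma card_prime_factors_le:
  fixes d :: nat
  assumes "d > 0" "d \<le> 2 ^ k"
  shows "card (prime_factors d) \<le> k"
proof -
  have "(2::nat) ^ card (prime_factors d) = (\<Prod>p\<in>prime_factors d. 2)" by simp
  also have "\<dots> \<le> (\<Prod>p\<in>prime_factors d. p ^ multiplicity p d)"
  proof (rule prod_mono, safe)
    fix p assume p: "p \<in> prime_factors d"
    then have "2 \<le> p" by (simp add: in_prime_factors_iff prime_ge_2_nat)
    also have "p \<le> p ^ multiplicity p d"
      using p \<open>2 \<le> p\<close> by (intro self_le_power) (auto simp: prime_factors_multiplicity)
    finally show "2 \<le> p ^ multiplicity p d" .
  qed
  also have "\<dots> = d" using assms prime_factorization_nat[of d] by simp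
  also have "\<dots> \<le> 2 ^ k" by fact
  finally show ?thesis by simp
qed

lemma sum_geometric_le:
  fixes x :: real
  assumes "0 \<le> x" "x < 1"
  shows "(\<Sum>a\<le>k. x ^ a) \<le> 1 / (1 - x)"
  using assms by (simp add: sum_gp0 divide_simps)

text \<open>The possible e in n = e f: odd primes not dividing d occur in e not at all or at least
  squared, while 2 and the primes dividing d are free. The bound by k truncates the local series at
  2, which would otherwise diverge.\<close>

definition cofactors :: "nat \<Rightarrow> nat \<Rightarrow> nat set" where
  "cofactors d k = {e. 0 < e \<and> bigomega e \<le> k \<and>
     (\<forall>p. prime p \<longrightarrow> odd p \<longrightarrow> \<not> p dvd d \<longrightarrow> multiplicity p e \<noteq> 1)}"

text \<open>An Euler product over three classes of primes, bounded by \<open>g1\<close>,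
  \<open>g2\<close> and \<open>g3\<close>. The prime 2 gives k + 1; the odd primes dividing d, at
  most k in number since d <= 2^k, give 2 k + 1; the remaining primes form a convergent product
  bounded by exp 3.\<close>

lemma sum_cofactors_le:
  assumes "finite E" "E \<subseteq> cofactors d k" "d > 0" "d \<le> 2 ^ k"
  shows "(\<Sum>e\<in>E. 2 ^ bigomega e / real e) \<le> exp 3 * (real k + 1) * (2 * real k + 1)"
proof -
  define P where "P = (\<Union>e\<in>E. prime_factors e)"
  define A where "A = (\<lambda>p::nat. {a. a \<le> k \<and> (odd p \<longrightarrow> \<not> p dvd d \<longrightarrow> a \<noteq> 1)})"
  have finP: "finite P" using assms(1) by (simp add: P_def)
  have prP: "prime p" if "p \<in> P" for p using that by (auto simp: P_def)
  have A_sub: "A p \<subseteq> {..k}" for p by (auto simp: A_def)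
  then have finA: "finite (A p)" for p by (rule finite_subset) simp
  have inA: "multiplicity p e \<in> A p" if "e \<in> E" "p \<in> P" for e p
  proof -
    have "multiplicity p e \<le> bigomega e"
    proof -
      have "multiplicity p e = count (prime_factorization e) p"
        using prP[OF that(2)] by (simp add: count_prime_factorization)
      also have "\<dots> \<le> (\<Sum>p\<in>P. count (prime_factorization e) p)"
        using that finP by (intro member_le_sum) auto
      also have "\<dots> = bigomega e"
        using that finP by (intro bigomega_eq_sum[symmetric]) (auto simp: P_def)
      finally show ?thesis .
    qed
    then show ?thesis using that assms(2) prP by (auto simp: A_def cofactors_def)
  qed
  define g1 where "g1 = (\<lambda>p::nat. if p = 2 then real k + 1 else 1)"
  define g2 where "g2 = (\<lambda>p::nat. if odd p \<and> p dvd d then real p / (real p - 2) else 1)"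
  define g3 where "g3 = (\<lambda>p::nat. if odd p \<and> \<not> p dvd d then exp (4 / (real p * (real p - 2))) else 1)"
  have odd3: "p \<ge> 3" if "p \<in> P" "odd p" for p
    using prime_ge_2_nat[OF prP[OF that(1)]] that(2) by (cases "p = 2") auto
  have factor: "(\<Sum>a\<in>A p. (2 / real p) ^ a) \<le> g1 p * g2 p * g3 p" if p: "p \<in> P" for p
  proof (cases "odd p")
    case False
    \<comment> \<open>Here 2 / p = 1, so the truncated series has at most k + 1 terms equal to
      1.\<close>
    then have "p = 2" using prP[OF p] by (metis primes_dvd_imp_eq two_is_prime_nat)
    then show ?thesis by (simp add: g1_def g2_def g3_def A_def atMost_def[symmetric])
  next
    case True
    then have p3: "real p \<ge> 3" using odd3[OF p] by simp
    have p2: "p \<noteq> 2" using True by auto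
    have geo: "(\<Sum>a\<le>k. (2 / real p) ^ a) \<le> real p / (real p - 2)" for k
    proof -
      have "(\<Sum>a\<le>k. (2 / real p) ^ a) \<le> 1 / (1 - 2 / real p)" using p3 by (intro sum_geometric_le) auto
      also have "\<dots> = real p / (real p - 2)" using p3 by (simp add: field_simps)
      finally show ?thesis .
    qed
    show ?thesis
    proof (cases "p dvd d")
      case dvd: True
      have "(\<Sum>a\<in>A p. (2 / real p) ^ a) \<le> (\<Sum>a\<le>k. (2 / real p) ^ a)"
        using A_sub by (intro sum_mono2) auto
      also note geo
      finally show ?thesis using True p2 dvd by (simp add: g1_def g2_def g3_def)
    next
      case ndvd: False
      \<comment> \<open>Exponent 1 is excluded for these primes, so the first nontrivial term is
        quadratic in 1 / p; this makes the product over p converge.\<close>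
      have "A p \<subseteq> insert 0 ((\<lambda>a. a + 2) ` {..k})"
      proof
        fix a assume "a \<in> A p"
        then have "a = 0 \<or> (a = (a - 2) + 2 \<and> a - 2 \<le> k)" using True ndvd by (auto simp: A_def)
        then show "a \<in> insert 0 ((\<lambda>a. a + 2) ` {..k})" by blast
      qed
      then have "(\<Sum>a\<in>A p. (2 / real p) ^ a) \<le> (\<Sum>a\<in>insert 0 ((\<lambda>a. a + 2) ` {..k}). (2 / real p) ^ a)"
        by (intro sum_mono2) auto
      also have "\<dots> = 1 + (\<Sum>a\<le>k. (2 / real p) ^ (a + 2))"
        by (subst sum.insert) (auto simp: sum.reindex inj_on_def)
      also have "(\<Sum>a\<le>k. (2 / real p) ^ (a + 2)) = (2 / real p)\<^sup>2 * (\<Sum>a\<le>k. (2 / real p) ^ a)"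
        unfolding sum_distrib_left power_add by (simp only: mult.commute)
      also have "1 + \<dots> \<le> 1 + (2 / real p)\<^sup>2 * (real p / (real p - 2))"
        by (intro add_left_mono mult_left_mono geo) auto
      also have "\<dots> = 1 + 4 / (real p * (real p - 2))" using p3 by (simp add: field_simps power2_eq_square)
      also have "\<dots> \<le> exp (4 / (real p * (real p - 2)))" by (rule exp_ge_add_one_self)
      finally show ?thesis using True p2 ndvd by (simp add: g1_def g2_def g3_def)
    qed
  qed
  have "(\<Sum>e\<in>E. 2 ^ bigomega e / real e) = (\<Sum>e\<in>E. \<Prod>p\<in>P. (2 / real p) ^ multiplicity p e)"
    using assms(2) finP prP
    by (intro sum.cong refl two_power_bigomega_div_eq) (auto simp: P_def cofactors_def)
  also have "\<dots> \<le> (\<Prod>p\<in>P. \<Sum>a\<in>A p. (2 / real p) ^ a)"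
    using finP finA inA assms(2) by (intro sum_le_euler_product) (auto simp: P_def cofactors_def)
  also have "\<dots> \<le> (\<Prod>p\<in>P. g1 p * g2 p * g3 p)"
    using factor by (intro prod_mono) (auto intro: sum_nonneg)
  also have "\<dots> = (\<Prod>p\<in>P. g1 p) * (\<Prod>p\<in>P. g2 p) * (\<Prod>p\<in>P. g3 p)"
    by (simp add: prod.distrib)
  also have "\<dots> \<le> (real k + 1) * (2 * real k + 1) * exp 3"
  proof -
    have 1: "(\<Prod>p\<in>P. g1 p) \<le> real k + 1"
      unfolding g1_def using finP by (simp add: prod.delta)
    have 2: "(\<Prod>p\<in>P. g2 p) \<le> 2 * real k + 1"
    proof -
      let ?S = "{p\<in>P. odd p \<and> p dvd d}"
      have "(\<Prod>p\<in>P. g2 p) = (\<Prod>p\<in>?S. real p / (real p - 2))"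
        unfolding g2_def by (rule prod.inter_filter[OF finP, symmetric])
      also have "\<dots> \<le> 2 * card ?S + 1"
        using finP odd3 by (intro prod_odd_ratio_le) auto
      also have "card ?S \<le> card (prime_factors d)"
        using assms(3) prP by (intro card_mono) (auto simp: in_prime_factors_iff)
      also have "\<dots> \<le> k" using assms by (intro card_prime_factors_le)
      finally show ?thesis by simp
    qed
    have 3: "(\<Prod>p\<in>P. g3 p) \<le> exp 3"
    proof -
      let ?S = "{p\<in>P. odd p \<and> \<not> p dvd d}"
      have "(\<Prod>p\<in>P. g3 p) = (\<Prod>p\<in>?S. exp (4 / (real p * (real p - 2))))"
        unfolding g3_def by (rule prod.inter_filter[OF finP, symmetric])
      also have "\<dots> = exp (\<Sum>p\<in>?S. 4 / (real p * (real p - 2)))" using finP by (simp add: exp_sum)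
      also have "\<dots> \<le> exp 3" using finP odd3 by (simp del: not_not) (intro sum_four_div_le, auto)
      finally show ?thesis .
    qed
    have nn: "(\<Prod>p\<in>P. g1 p) \<ge> 0" "(\<Prod>p\<in>P. g2 p) \<ge> 0" "(\<Prod>p\<in>P. g3 p) \<ge> 0"
      using odd3 by (force intro!: prod_nonneg divide_nonneg_nonneg simp: g1_def g2_def g3_def)+
    show ?thesis using 1 2 3 nn by (intro mult_mono) auto
  qed
  finally show ?thesis by (simp add: mult_ac)
qed

section \<open>Factorization of represented integers\<close>

text \<open>If p divided y it would divide x as well, and then p^2 would divide n, against
  multiplicity one. Hence y has an inverse w modulo p, and z = x w works.\<close>

lemma root_of_represented:
  fixes n d :: nat and x y :: int
  assumes "prime p" "multiplicity p n = 1" "int n = x\<^sup>2 + int d * y\<^sup>2"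
  shows "\<exists>z. int p dvd z\<^sup>2 + int d"
proof -
  have pp: "prime (int p)" using assms(1) by simp
  have "n \<noteq> 0" using assms(2) by (cases "n = 0") auto
  have pn: "p dvd n" using assms(2) by (metis not_dvd_imp_multiplicity_0 zero_neq_one)
  have p2: "\<not> p\<^sup>2 dvd n"
    using assms(1,2) \<open>n \<noteq> 0\<close> by (subst power_dvd_iff_le_multiplicity) auto
  have pn': "int p dvd int n" and p2': "\<not> (int p)\<^sup>2 dvd int n"
    using pn p2 by (simp_all flip: of_nat_power add: int_dvd_int_iff)
  have "\<not> int p dvd y"
  proof
    assume y: "int p dvd y"
    then have "int p dvd int d * y\<^sup>2" by (simp add: power2_eq_square)
    then have "int p dvd x\<^sup>2" using pn' assms(3) by (metis dvd_add_left_iff)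
    then have "int p dvd x" using pp by (simp add: prime_dvd_power_iff)
    then have "(int p)\<^sup>2 dvd x\<^sup>2" "(int p)\<^sup>2 dvd int d * y\<^sup>2" using y by (auto simp: dvd_power_same)
    then show False using p2' assms(3) by simp
  qed
  then have "coprime y (int p)" using pp by (metis prime_imp_coprime coprime_commute)
  then obtain w where "[y * w = 1] (mod int p)" using cong_solve_coprime_int by blast
  then have w: "int p dvd y * w - 1" by (simp add: cong_iff_dvd_diff)
  have "(x * w)\<^sup>2 + int d = int n * w\<^sup>2 - int d * (y * w + 1) * (y * w - 1)"
    unfolding assms(3) by (simp add: algebra_simps power2_eq_square)
  then have "int p dvd (x * w)\<^sup>2 + int d" using w pn' by simp
  then show ?thesis by blast
qed

text \<open>S consists of the primes at which -d has two roots by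
  \<open>root_of_represented\<close>. Since f is their product, bigomega f = card S, which turns
  2^(card S) roots modulo f into 2^(k - bigomega e).\<close>

lemma represented_factorization:
  fixes n d :: nat and x y :: int
  assumes "n > 0" "int n = x\<^sup>2 + int d * y\<^sup>2" "bigomega n = k"
  obtains e f where "n = e * f" "e \<in> cofactors d k" "f > 0"
    "2 ^ k \<le> 2 ^ bigomega e * card (neg_sqroots (int d) (int f))"
proof -
  define S where "S = {p\<in>prime_factors n. multiplicity p n = 1 \<and> odd p \<and> \<not> p dvd d}"
  define e where "e = (\<Prod>p\<in>prime_factors n - S. p ^ multiplicity p n)"
  define f where "f = \<Prod>S"
  have fin: "finite S" and pr: "\<And>p. p \<in> S \<Longrightarrow> prime p" by (auto simp: S_def)
  have f0: "f > 0" unfolding f_def using pr by (intro prod_pos) (auto simp: prime_gt_0_nat)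
  have n: "n = e * f"
  proof -
    have "n = (\<Prod>p\<in>prime_factors n. p ^ multiplicity p n)" using assms(1) by (rule prime_factorization_nat)
    also have "\<dots> = e * (\<Prod>p\<in>S. p ^ multiplicity p n)"
      unfolding e_def by (rule prod.subset_diff) (auto simp: S_def)
    also have "(\<Prod>p\<in>S. p ^ multiplicity p n) = f"
      unfolding f_def by (rule prod.cong) (auto simp: S_def)
    finally show ?thesis .
  qed
  have e0: "e > 0" using n assms(1) by (cases "e = 0") auto
  have om: "k = bigomega e + card S"
    using assms(3) bigomega_mult[of e f] bigomega_prod_primes[OF fin pr] e0 f0 unfolding n f_def by simp
  have "multiplicity p e \<noteq> 1" if p: "prime p" "odd p" "\<not> p dvd d" for p
  proof
    assume 1: "multiplicity p e = 1"
    have "multiplicity p e = (if p \<in> prime_factors n - S then multiplicity p n else 0)"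
      unfolding e_def using p(1) by (intro multiplicity_prod_prime_powers) auto
    then show False using 1 p by (auto simp: S_def split: if_splits)
  qed
  then have "e \<in> cofactors d k" using e0 om by (simp add: cofactors_def)
  moreover have "2 ^ card S \<le> card (neg_sqroots (int d) (int f))"
    unfolding f_def using root_of_represented[OF _ _ assms(2)] fin
    by (intro two_power_le_card_neg_sqroots) (auto simp: S_def)
  then have "2 ^ k \<le> 2 ^ bigomega e * card (neg_sqroots (int d) (int f))"
    unfolding om power_add by (intro mult_left_mono) auto
  ultimately show thesis using that n f0 by blast
qed

text \<open>Write e = r g^2 with r squarefree. A prime dividing r is 2, or divides d, or has
  exponent at least 2 in e and hence divides g. So r divides 2 d g, and e <= 2 d g^3.\<close>

lemma cofactor_le:
  assumes e: "e \<in> cofactors d k" and d: "d > 0" and sq: "\<And>g. g\<^sup>2 dvd e \<Longrightarrow> real g \<le> K"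
  shows "real e \<le> 2 * real d * K ^ 3"
proof -
  define g where "g = square_part e"
  define r where "r = squarefree_part e"
  have e0: "e > 0" using e by (simp add: cofactors_def)
  have eq: "e = r * g\<^sup>2" unfolding r_def g_def by (rule squarefree_decompose)
  have g0: "g > 0" using e0 eq by (cases "g = 0") auto
  have "r dvd 2 * d * g"
  proof (subst prime_multiplicity_le_imp_dvd, safe)
    fix p :: nat assume p: "prime p"
    have "r dvd e" unfolding eq by simp
    show "multiplicity p r \<le> multiplicity p (2 * d * g)"
    proof (cases "p dvd r")
      case True
      have "p dvd 2 * d * g"
      proof (cases "p = 2 \<or> p dvd d")
        case False
        then have "odd p" using p by (metis primes_dvd_imp_eq two_is_prime_nat)
        then have "multiplicity p e \<noteq> 1" using e p False by (simp add: cofactors_def)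
        moreover have "multiplicity p e \<noteq> 0"
          using True \<open>r dvd e\<close> e0 p by (metis dvd_trans multiplicity_eq_zero_iff not_prime_unit not_gr_zero)
        ultimately have "multiplicity p g \<noteq> 0"
          unfolding g_def using p by (simp add: prime_multiplicity_square_part)
        then show ?thesis by (metis dvd_mult not_dvd_imp_multiplicity_0)
      qed auto
      then have "multiplicity p (2 * d * g) \<ge> 1"
        using d g0 p by (intro multiplicity_geI) auto
      moreover have "multiplicity p r \<le> 1"
        unfolding r_def using prime_multiplicity_squarefree_part_le_Suc_0[OF p] by simp
      ultimately show ?thesis by linarith
    qed (simp add: not_dvd_imp_multiplicity_0)
  qed (use d g0 e0 eq in auto)
  then have "r \<le> 2 * d * g" using d g0 by (intro dvd_imp_le) auto
  then have "e \<le> 2 * d * g ^ 3" unfolding eq by (simp add: power2_eq_square power3_eq_cube)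
  then have "real e \<le> 2 * real d * real g ^ 3"
    by (metis of_nat_le_iff of_nat_mult of_nat_numeral of_nat_power)
  also have "\<dots> \<le> 2 * real d * K ^ 3"
    using sq[of g] unfolding eq by (intro mult_left_mono power_mono) auto
  finally show ?thesis .
qed

section \<open>Integers divisible by a large square\<close>

lemma sum_inverse_squares_le:
  fixes L Z :: nat
  assumes "L \<ge> 1"
  shows "(\<Sum>g=L..Z. 1 / (real g)\<^sup>2) \<le> 2 / L"
proof (cases "L \<le> Z + 1")
  case True
  have "(\<Sum>g=L..Z. 1 / (real g)\<^sup>2) \<le> (\<Sum>g=L..Z. - 2 / real (Suc g) - (- 2 / real g))"
  proof (rule sum_mono)
    fix g assume "g \<in> {L..Z}"
    then have "real g \<ge> 1" using assms by auto
    then show "1 / (real g)\<^sup>2 \<le> - 2 / real (Suc g) - (- 2 / real g)"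
      by (simp add: divide_simps power2_eq_square)
  qed
  also have "\<dots> = - 2 / real (Suc Z) - (- 2 / real L)"
    using True by (intro sum_Suc_diff) auto
  also have "\<dots> \<le> 2 / real L" by (simp add: divide_simps)
  finally show ?thesis .
qed auto

text \<open>Union bound: at most N / g^2 integers are divisible by g^2, and these bounds are summed
  over g > K.\<close>

lemma card_multiples_of_squares_le:
  assumes "K > 0" "N \<ge> 0"
  shows "real (card {n::nat. 0 < n \<and> real n \<le> N \<and> (\<exists>g. K < real g \<and> g\<^sup>2 dvd n)}) \<le> 2 * N / K"
proof -
  \<comment> \<open>L is the least natural number exceeding K. The range of g ends at Z because g <=
    g^2 <= n <= N.\<close>
  define L where "L = nat \<lfloor>K\<rfloor> + 1"
  define Z where "Z = nat \<lfloor>N\<rfloor>"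
  define J where "J = (\<lambda>g::nat. nat \<lfloor>N / (real g)\<^sup>2\<rfloor>)"
  have LK: "real L > K" using assms unfolding L_def by linarith
  let ?S = "{n::nat. 0 < n \<and> real n \<le> N \<and> (\<exists>g. K < real g \<and> g\<^sup>2 dvd n)}"
  have sub: "?S \<subseteq> (\<Union>g\<in>{L..Z}. (\<lambda>j. g\<^sup>2 * j) ` {1..J g})"
  proof
    fix n assume "n \<in> ?S"
    then obtain g j where n: "0 < n" "real n \<le> N" "K < real g" "n = g\<^sup>2 * j" by (auto elim: dvdE)
    have j: "j \<ge> 1" "g \<ge> 1" using n by (auto simp: Suc_le_eq intro!: gr0I)
    have "g \<le> g * (g * j)" using j by simp
    then have "g \<le> n" unfolding n(4) by (simp only: power2_eq_square mult.assoc)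
    then have "real g \<le> N" using n(2) by linarith
    then have "g \<le> Z" unfolding Z_def by (simp add: le_nat_floor)
    moreover have "L \<le> g" using n(3) assms(1) unfolding L_def by linarith
    moreover have "real j \<le> N / (real g)\<^sup>2" using n j by (simp add: field_simps)
    then have "j \<le> J g" unfolding J_def by (simp add: le_nat_floor)
    ultimately show "n \<in> (\<Union>g\<in>{L..Z}. (\<lambda>j. g\<^sup>2 * j) ` {1..J g})" using n(4) j(1)
      by (intro UN_I[of g] image_eqI[of _ _ j]) auto
  qed
  have "card ?S \<le> card (\<Union>g\<in>{L..Z}. (\<lambda>j. g\<^sup>2 * j) ` {1..J g})"
    using sub by (intro card_mono) auto
  also have "\<dots> \<le> (\<Sum>g=L..Z. card ((\<lambda>j. g\<^sup>2 * j) ` {1..J g}))" by (intro card_UN_le) auto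
  also have "\<dots> \<le> (\<Sum>g=L..Z. J g)" by (intro sum_mono order_trans[OF card_image_le]) auto
  finally have "real (card ?S) \<le> (\<Sum>g=L..Z. real (J g))" by (simp flip: of_nat_sum)
  also have "\<dots> \<le> (\<Sum>g=L..Z. N * (1 / (real g)\<^sup>2))"
    using assms by (intro sum_mono) (simp add: J_def)
  also have "\<dots> \<le> N * (2 / L)"
    unfolding sum_distrib_left[symmetric] using assms
    by (intro mult_left_mono sum_inverse_squares_le) (auto simp: L_def)
  also have "\<dots> \<le> N * (2 / K)" using assms LK by (intro mult_left_mono divide_left_mono) auto
  finally show ?thesis by (simp add: mult_ac)
qed

lemma finite_almost_primes: "finite (almost_primes N k)"
proof (rule finite_subset)
  show "almost_primes N k \<subseteq> {..nat \<lfloor>N\<rfloor>}" by (auto simp: almost_primes_def le_nat_floor)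
qed simp

section \<open>The count of represented almost primes\<close>

text \<open>The bound for a single d: sum over f <= N / e by \<open>sum_card_neg_sqroots_le\<close>,
  then over e by \<open>sum_cofactors_le\<close>. Square divisors bounded by K force e <= 2 d K^3,
  and the lower bound on N then yields 2 d <= N / e, as the first of these sums needs.\<close>

lemma card_represented_le:
  fixes N K :: real and d k :: nat
  assumes d: "1 \<le> d" "d \<le> 2 ^ k" and N: "4 * (real d)\<^sup>2 * K ^ 3 \<le> N" and N0: "N \<ge> 0"
  shows "real (card {n \<in> almost_primes N k. (\<forall>g. g\<^sup>2 dvd n \<longrightarrow> real g \<le> K) \<and>
      (\<exists>x y. int n = x\<^sup>2 + int d * y\<^sup>2)})
    \<le> 9 * exp 3 * (real k + 1) * (2 * real k + 1) / 2 ^ k * N *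
      (1 / sqrt d * (\<Sum>m=1..\<lfloor>2 * sqrt d\<rfloor>. real (card (neg_sqroots d m))))"
    (is "real (card ?G) \<le> _ * _ * _")
proof -
  define \<Lambda> where "\<Lambda> = (\<Sum>m=1..\<lfloor>2 * sqrt d\<rfloor>. real (card (neg_sqroots d m)))"
  define E where "E = {e \<in> cofactors d k. real e \<le> 2 * real d * K ^ 3}"
  define X where "X = (\<lambda>e::nat. \<lfloor>N / e\<rfloor>)"
  define F where "F = (\<lambda>e. {f::nat. 0 < f \<and> int f \<le> X e \<and>
    2 ^ k \<le> 2 ^ bigomega e * card (neg_sqroots (int d) (int f))})"
  have finE: "finite E"
    by (rule finite_subset[of _ "{..nat \<lfloor>2 * real d * K ^ 3\<rfloor>}"]) (auto simp: E_def le_nat_floor)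
  have finF: "finite (F e)" for e
    by (rule finite_subset[of _ "{..nat (X e)}"]) (auto simp: F_def)
  have sub: "?G \<subseteq> (\<Union>e\<in>E. (\<lambda>f. e * f) ` F e)"
  proof
    fix n assume n: "n \<in> ?G"
    then obtain x y where xy: "int n = x\<^sup>2 + int d * y\<^sup>2" by blast
    have n0: "n > 0" "bigomega n = k" "real n \<le> N" using n by (auto simp: almost_primes_def)
    obtain e f where ef: "n = e * f" "e \<in> cofactors d k" "f > 0"
      "2 ^ k \<le> 2 ^ bigomega e * card (neg_sqroots (int d) (int f))"
      using represented_factorization[OF n0(1) xy n0(2)] by blast
    have e0: "e > 0" using ef n0 by (cases "e = 0") auto
    have "real g \<le> K" if "g\<^sup>2 dvd e" for g using that n ef(1) by auto
    then have "e \<in> E" using cofactor_le[OF ef(2)] d ef(2) by (simp add: E_def)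
    moreover have "real f \<le> N / e" using n0(3) e0 ef(1) by (simp add: field_simps)
    then have "f \<in> F e" using ef by (simp add: F_def X_def le_floor_iff)
    ultimately show "n \<in> (\<Union>e\<in>E. (\<lambda>f. e * f) ` F e)" using ef(1) by blast
  qed
  have \<Lambda>0: "\<Lambda> \<ge> 0" unfolding \<Lambda>_def by (intro sum_nonneg) auto
  have cF: "real (card (F e)) \<le> 2 ^ bigomega e / real e * (9 / 2 ^ k * N * (1 / sqrt d * \<Lambda>))"
    if e: "e \<in> E" for e
  proof -
    have e0: "real e > 0" using e by (auto simp: E_def cofactors_def)
    have "2 * real d * e \<le> 2 * real d * (2 * real d * K ^ 3)"
      using e by (intro mult_left_mono) (auto simp: E_def)
    also have "\<dots> \<le> N" using N by (simp add: power2_eq_square mult_ac)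
    finally have "real_of_int (2 * int d) \<le> N / e" using e0 by (simp add: field_simps)
    then have dX: "2 * int d \<le> X e" unfolding X_def by (simp only: le_floor_iff)
    \<comment> \<open>Each f in \<open>F e\<close> is majorized by its number of roots: the weight
      2^(bigomega e) times that number is at least 2^k.\<close>
    have "2 ^ k * real (card (F e)) = (\<Sum>f\<in>F e. 2 ^ k)" by simp
    also have "\<dots> \<le> (\<Sum>f\<in>F e. 2 ^ bigomega e * real (card (neg_sqroots (int d) (int f))))"
    proof (rule sum_mono)
      fix f assume "f \<in> F e"
      then have "2 ^ k \<le> 2 ^ bigomega e * card (neg_sqroots (int d) (int f))" by (simp add: F_def)
      then have "real (2 ^ k) \<le> real (2 ^ bigomega e * card (neg_sqroots (int d) (int f)))"
        by (simp only: of_nat_le_iff)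
      then show "(2::real) ^ k \<le> 2 ^ bigomega e * real (card (neg_sqroots (int d) (int f)))" by simp
    qed
    also have "\<dots> = 2 ^ bigomega e * (\<Sum>n\<in>int ` F e. real (card (neg_sqroots (int d) n)))"
      by (simp add: sum_distrib_left sum.reindex)
    also have "\<dots> \<le> 2 ^ bigomega e * (\<Sum>n=1..X e. real (card (neg_sqroots (int d) n)))"
      by (intro mult_left_mono sum_mono2) (auto simp: F_def)
    also have "\<dots> \<le> 2 ^ bigomega e * (9 * X e / sqrt d * \<Lambda>)"
      using sum_card_neg_sqroots_le[OF _ dX] d unfolding \<Lambda>_def by (intro mult_left_mono) auto
    also have "\<dots> \<le> 2 ^ bigomega e * (9 * (N / e) / sqrt d * \<Lambda>)"
    proof -
      have "9 * real_of_int (X e) \<le> 9 * (N / e)" unfolding X_def by (intro mult_left_mono) auto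
      then show ?thesis using \<Lambda>0 by (intro mult_left_mono mult_right_mono divide_right_mono) auto
    qed
    also have "\<dots> = 2 ^ k * (2 ^ bigomega e / real e * (9 / 2 ^ k * N * (1 / sqrt d * \<Lambda>)))" by simp
    finally show ?thesis by (rule mult_left_le_imp_le) simp
  qed
  have "card ?G \<le> card (\<Union>e\<in>E. (\<lambda>f. e * f) ` F e)"
    using sub finE finF by (intro card_mono) auto
  also have "\<dots> \<le> (\<Sum>e\<in>E. card ((\<lambda>f. e * f) ` F e))" using finE by (rule card_UN_le)
  also have "\<dots> \<le> (\<Sum>e\<in>E. card (F e))" by (intro sum_mono card_image_le finF)
  finally have "real (card ?G) \<le> (\<Sum>e\<in>E. real (card (F e)))" by (simp flip: of_nat_sum)
  also have "\<dots> \<le> (\<Sum>e\<in>E. 2 ^ bigomega e / real e * (9 / 2 ^ k * N * (1 / sqrt d * \<Lambda>)))"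
    by (intro sum_mono cF)
  also have "\<dots> \<le> exp 3 * (real k + 1) * (2 * real k + 1) * (9 / 2 ^ k * N * (1 / sqrt d * \<Lambda>))"
    unfolding sum_distrib_right[symmetric] using finE d N0 \<Lambda>0
    by (intro mult_right_mono sum_cofactors_le) (auto simp: E_def)
  also have "\<dots> = 9 * exp 3 * (real k + 1) * (2 * real k + 1) / 2 ^ k * N * (1 / sqrt d * \<Lambda>)"
    by (simp only: times_divide_eq_left times_divide_eq_right mult_ac)
  finally show ?thesis unfolding \<Lambda>_def .
qed

text \<open>For L = ln (ln N) this is the size condition of \<open>card_represented_le\<close>, with
  exp (3 L / 2) bounding d. The left side is at most 108 exp (4 L) <= exp (5 L + 1), and exp L >= 1
  + L + L^2 / 2 >= 5 L + 1 once L >= 8.\<close>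

lemma exp_mult_cube_le_exp_exp:
  fixes L :: real
  assumes "L \<ge> 8"
  shows "4 * exp (3 * L) * L ^ 3 \<le> exp (exp L)"
proof -
  have "L\<^sup>2 / 2 \<ge> 4 * L" using assms by (simp add: power2_eq_square)
  then have eL: "exp L \<ge> 5 * L + 1" using exp_lower_Taylor_quadratic[of L] assms by linarith
  have "1 + L / 3 \<le> exp (L / 3)" by (rule exp_ge_add_one_self)
  then have "(L / 3) ^ 3 \<le> exp (L / 3) ^ 3" using assms by (intro power_mono) linarith+
  also have "exp (L / 3) ^ 3 = exp L" by (simp flip: exp_of_nat_mult)
  finally have "L ^ 3 \<le> 27 * exp L" by (simp add: power_divide)
  then have "4 * exp (3 * L) * L ^ 3 \<le> 4 * exp (3 * L) * (27 * exp L)" by (intro mult_left_mono) auto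
  also have "\<dots> = 108 * exp (4 * L)" by (simp flip: exp_add)
  also have "\<dots> \<le> exp (L + 1) * exp (4 * L)"
  proof (rule mult_right_mono)
    have "(2::real) ^ 9 \<le> exp 1 ^ 9" using exp_ge_add_one_self[of 1] by (intro power_mono) auto
    also have "\<dots> = exp 9" by (simp flip: exp_of_nat_mult)
    also have "\<dots> \<le> exp (L + 1)" using assms by simp
    finally show "108 \<le> exp (L + 1)" by simp
  qed simp
  also have "\<dots> \<le> exp (exp L)" using eL by (simp flip: exp_add)
  finally show ?thesis .
qed

theorem theorem1p3:
  "\<exists>C>0. \<exists>N\<^sub>0::real. \<forall>N\<ge>N\<^sub>0. \<forall>(k::nat) (\<Delta>::real).
     \<bar>real k - ln (ln N)\<bar> \<le> ln (ln N) powr (2/3) \<longrightarrow>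
     \<Delta> \<le> 2 ^ k / real k ^ 4 \<longrightarrow>
     real (card {n \<in> almost_primes N k.
        \<exists>(d::int) (x::int) (y::int).
          1 \<le> d \<and> real_of_int d \<le> \<Delta> \<and> int n = x\<^sup>2 + d * y\<^sup>2})
       \<le> C * (N / ln (ln N))"
\<comment> \<open>864 = 9 * 8 * 6 * 2: lattice points, the average over d, (k + 1) (2 k + 1) <= 6
  k^2, and k >= L / 2. The summand 2 accounts for large square divisors. The threshold makes L >= 8,
  so that L^(2/3) <= L / 2.\<close>
proof (rule exI[of _ "864 * exp 3 + 2"], rule conjI[rotated], rule exI[of _ "exp (exp 8)"], safe)
  fix N \<Delta> :: real and k :: nat
  assume N: "N \<ge> exp (exp 8)" and k: "\<bar>real k - ln (ln N)\<bar> \<le> ln (ln N) powr (2/3)"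
    and \<Delta>: "\<Delta> \<le> 2 ^ k / real k ^ 4"
  define L where "L = ln (ln N)"
  have N0: "N > 0" using N by (metis exp_gt_zero less_le_trans)
  have lnN: "ln N \<ge> exp 8" using N N0 by (simp add: ln_ge_iff)
  then have lnN0: "ln N > 0" by (metis exp_gt_zero less_le_trans)
  have L8: "L \<ge> 8" using lnN lnN0 unfolding L_def by (simp add: ln_ge_iff)
  have NL: "N = exp (exp L)" unfolding L_def using N0 lnN0 by simp
  have "L powr (2/3) \<le> L / 2"
  proof -
    have "2 = (8::real) powr (1/3)" by (simp add: powr_def ln_realpow[of 2 3, simplified])
    also have "\<dots> \<le> L powr (1/3)" using L8 by (intro powr_mono2) auto
    finally have "2 * L powr (2/3) \<le> L powr (1/3) * L powr (2/3)" by (intro mult_right_mono) auto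
    also have "\<dots> = L" using L8 by (simp flip: powr_add)
    finally show ?thesis by simp
  qed
  then have kL: "L / 2 \<le> real k" "real k \<le> 3 / 2 * L" using k unfolding L_def[symmetric] by linarith+
  then have k1: "real k \<ge> 1" using L8 by linarith
  define D where "D = \<lfloor>\<Delta>\<rfloor>"
  define G where "G = (\<lambda>d. {n \<in> almost_primes N k. (\<forall>g. g\<^sup>2 dvd n \<longrightarrow> real g \<le> L) \<and>
      (\<exists>x y. int n = x\<^sup>2 + d * y\<^sup>2)})"
  define B where "B = {n::nat. 0 < n \<and> real n \<le> N \<and> (\<exists>g. L < real g \<and> g\<^sup>2 dvd n)}"
  define \<Lambda> where "\<Lambda> = (\<lambda>d::int. 1 / sqrt d * (\<Sum>m=1..\<lfloor>2 * sqrt d\<rfloor>. real (card (neg_sqroots d m))))"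
  define c where "c = 9 * exp 3 * (real k + 1) * (2 * real k + 1) / 2 ^ k * N"
  let ?T = "{n \<in> almost_primes N k. \<exists>(d::int) (x::int) (y::int).
          1 \<le> d \<and> real_of_int d \<le> \<Delta> \<and> int n = x\<^sup>2 + d * y\<^sup>2}"
  have finB: "finite B"
    by (rule finite_subset[of _ "{..nat \<lfloor>N\<rfloor>}"]) (auto simp: B_def le_nat_floor)
  have finG: "finite (G d)" for d
    unfolding G_def by (rule finite_subset[OF _ finite_almost_primes]) blast
  have "?T \<subseteq> B \<union> (\<Union>d\<in>{1..D}. G d)"
  proof
    fix n assume n: "n \<in> ?T"
    then obtain d x y where d: "1 \<le> d" "real_of_int d \<le> \<Delta>" "int n = x\<^sup>2 + d * y\<^sup>2" by blast
    have "d \<in> {1..D}" using d by (simp add: D_def le_floor_iff)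
    moreover have "n \<in> B \<or> n \<in> G d"
      using n d(3) by (auto simp: B_def G_def almost_primes_def not_le)
    ultimately show "n \<in> B \<union> (\<Union>d\<in>{1..D}. G d)" by blast
  qed
  then have "card ?T \<le> card (B \<union> (\<Union>d\<in>{1..D}. G d))" using finB finG by (intro card_mono) auto
  also have "\<dots> \<le> card B + card (\<Union>d\<in>{1..D}. G d)" by (rule card_Un_le)
  also have "\<dots> \<le> card B + (\<Sum>d=1..D. card (G d))" by (intro add_left_mono card_UN_le) auto
  finally have "real (card ?T) \<le> real (card B + (\<Sum>d=1..D. card (G d)))" by (simp only: of_nat_le_iff)
  then have "real (card ?T) \<le> real (card B) + (\<Sum>d=1..D. real (card (G d)))" by simp
  moreover have "real (card B) \<le> 2 * (N / L)"
    using card_multiples_of_squares_le[of L N] L8 N0 unfolding B_def by simp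
  moreover have "(\<Sum>d=1..D. real (card (G d))) \<le> 864 * exp 3 * (N / L)"
  proof (cases "D \<ge> 1")
    case True
    have D: "real_of_int D \<le> 2 ^ k / real k ^ 4" using \<Delta> unfolding D_def by linarith
    have G: "real (card (G d)) \<le> c * \<Lambda> d" if d: "d \<in> {1..D}" for d
    proof -
      obtain d' where d': "d = int d'" using d by (metis atLeastAtMost_iff nonneg_int_cases order_trans zero_le_one)
      have "2 ^ k / real k ^ 4 \<le> 2 ^ k" using k1 by (simp add: divide_simps one_le_power)
      moreover have "real d' \<le> real_of_int D" using d d' by auto
      ultimately have "real d' \<le> 2 ^ k" using D by linarith
      then have 2: "d' \<le> 2 ^ k" by (metis of_nat_le_iff of_nat_numeral of_nat_power)
      \<comment> \<open>Size condition: d <= 2^k <= exp k and k <= 3 L / 2 give d^2 <= exp (3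
        L).\<close>
      have "(real d')\<^sup>2 \<le> (2 ^ k)\<^sup>2" using \<open>real d' \<le> 2 ^ k\<close> by (intro power_mono) auto
      also have "\<dots> \<le> (exp k)\<^sup>2"
      proof (intro power_mono)
        have "(2::real) ^ k \<le> exp 1 ^ k" using exp_ge_add_one_self[of 1] by (intro power_mono) auto
        then show "(2::real) ^ k \<le> exp k" by (simp flip: exp_of_nat_mult)
      qed auto
      also have "\<dots> = exp (2 * k)" by (simp flip: exp_of_nat_mult)
      also have "\<dots> \<le> exp (3 * L)" using kL by simp
      finally have "4 * (real d')\<^sup>2 * L ^ 3 \<le> 4 * exp (3 * L) * L ^ 3"
        using L8 by (intro mult_right_mono mult_left_mono) auto
      also have "\<dots> \<le> N" unfolding NL using L8 by (rule exp_mult_cube_le_exp_exp)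
      finally show ?thesis
        using card_represented_le[of d' k L N] 2 d d' N0 unfolding G_def c_def \<Lambda>_def by simp
    qed
    have c0: "c \<ge> 0" using N0 by (simp add: c_def)
    have "(\<Sum>d=1..D. real (card (G d))) \<le> (\<Sum>d=1..D. c * \<Lambda> d)" by (intro sum_mono G)
    also have "\<dots> \<le> c * (8 * D)"
      unfolding sum_distrib_left[symmetric] \<Lambda>_def
      using c0 sum_sum_card_neg_sqroots_le[OF True] by (intro mult_left_mono) auto
    also have "\<dots> \<le> c * (8 * (2 ^ k / real k ^ 4))" using c0 D by (intro mult_left_mono) auto
    also have "\<dots> = 72 * exp 3 * N * ((real k + 1) * (2 * real k + 1)) / real k ^ 4"
      by (simp add: c_def)
    also have "\<dots> \<le> 72 * exp 3 * N * (6 * real k ^ 2) / real k ^ 4"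
    proof (intro divide_right_mono mult_left_mono)
      have "(real k + 1) * (2 * real k + 1) \<le> (2 * real k) * (3 * real k)"
        using k1 by (intro mult_mono) auto
      then show "(real k + 1) * (2 * real k + 1) \<le> 6 * real k ^ 2" by (simp add: power2_eq_square)
    qed (use N0 in auto)
    also have "\<dots> = 432 * exp 3 * N / (real k * real k)" using k1 by (simp add: field_simps power2_eq_square power4_eq_xxxx)
    \<comment> \<open>One factor k is bounded below only by 1: the bound for \<open>B\<close> is
      already of order N / L.\<close>
    also have "\<dots> \<le> 432 * exp 3 * N / (1 * (L / 2))"
      using k1 kL N0 L8 by (intro divide_left_mono mult_mono) auto
    finally show ?thesis by simp
  qed (use N0 L8 in auto)
  ultimately show "real (card ?T) \<le> (864 * exp 3 + 2) * (N / ln (ln N))"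
    unfolding L_def[symmetric] distrib_right by linarith
qed (simp add: add_pos_pos)

end
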